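(* Let $I=\{i_1,\dots,i_k\}\subset J$ be a $k$-element subset and $\bar I=J\setminus I$. Write $z_I=(z_i)_{i\in I}$, $p_{\bar I}=(p_j)_{j\in\bar I}$, and let $\Psi_I(z_I,p_{\bar I})$ be the function obtained from $$\Psi=\sum_{j\in J}a_j\ln p_j-\sum_{i\in I}z_ip_i$$ by expressing the variables $p_i$, $i\in I$, through $p_{\bar I}$ by the formulas $$p_{i_m}=-\frac1{d_{i_m,i_1,\dots,\widehat{i_m},\dots,i_k}}\sum_{j\in\bar I}d_{j,i_1,\dots,\widehat{i_m},\dots,i_k}\,p_j,\qquad m=1,\dots,k.$$ Then $\Psi_I$ is a generating function of the Lagrangian variety $\Lambda$; namely, $\Lambda$ lies in the image of the map $$(z_I,p_{\bar I})\mapsto\Big(z_I,\ z_{\bar I}=\frac{\partial\Psi_I}{\partial p_{\bar I}}(z_I,p_{\bar I}),\ p_I=-\frac{\partial\Psi_I}{\partial z_I}(z_I,p_{\bar I}),\ p_{\bar I}\Big),$$ defined for those $(z_I,p_{\bar I})\in\mathbb C^k\times\mathbb C^{n-k}$ for which all $p_j$, $j\in J$ (those with $j\in I$ being given by the formulas displayed) are nonzero.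
   Context: Let $n>k$ be positive integers, $J=\{1,\dots,n\}$. Let $t_1,\dots,t_k$ be coordinates on $\mathbb C^k$ and $z_1,\dots,z_n$ coordinates on $\mathbb C^n$. Fix linear functions $g_j=\sum_{m=1}^k b_j^m t_m$, $j\in J$, with $b_j^m\in\mathbb C$, and put $d_{i_1,\dots,i_k}=\det_{\ell,m=1}^k(b^m_{i_\ell})$. Assume $d_{i_1,\dots,i_k}\neq0$ whenever $i_1,\dots,i_k\in J$ are distinct. Put $f_j(z,t)=z_j+g_j(t)$ on $\mathbb C^n\times\mathbb C^k$. For distinct $i_1,\dots,i_{k+1}\in J$ put $$f_{i_1,\dots,i_{k+1}}(z)=\sum_{m=1}^{k+1}(-1)^{m-1}d_{i_1,\dots,\widehat{i_m},\dots,i_{k+1}}z_{i_m},$$ and let $\Delta\subset\mathbb C^n$ be the union over all $(k+1)$-element subsets $\{i_1<\dots<i_{k+1}\}\subset J$ of the hyperplanes $f_{i_1,\dots,i_{k+1}}(z)=0$. Fix nonzero weights $a_j\in\mathbb C^\times$, $j\in J$, with $|a|=\sum_{j\in J}a_j\neq0$. The master function is $\Phi(z,t)=\sum_{j\in J}a_j\log f_j(z,t)$. Let $U^0=\{(z,t)\in\mathbb C^n\times\mathbb C^k : z\notin\Delta,\ f_j(z,t)\ne0\ \text{for all } j\in J\}$ and $C_\Phi=\{(z,t)\in U^0: \partial\Phi/\partial t_i(z,t)=0,\ i=1,\dots,k\}$. Consider the map $\phi:C_\Phi\to(\mathbb C^n-\Delta)\times(\mathbb C^\times)^n$, $(z,t)\mapsto(z_1,\dots,z_n,p_1,\dots,p_n)$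 with $p_j=\frac{\partial\Phi}{\partial z_j}(z,t)=a_j/f_j(z,t)$, and put $\Lambda=\phi(C_\Phi)$. It is a Lagrangian subvariety with respect to $\omega=\sum_{j=1}^n dp_j\wedge dz_j$. The functions $\ln p_j$ are multivalued, but the first partial derivatives of $\Psi_I$ are single-valued. *)

theory Defs
  imports
    "HOL-Analysis.Complex_Transcendental"
    "HOL-Library.FuncSet"
    "Jordan_Normal_Form.Determinant"
begin

text \<open>
  All indices start at 1, and \<open>b j m\<close> is $b_j^m$. A point of \<open>\<complex>\<^sup>A\<close>, for a finite set \<open>A\<close> of
  indices, is an extensional function on \<open>A\<close>; so $\mathbb C^n$ is \<open>cspace {1..n}\<close>, and
  $z_I$ is an element of \<open>cspace I\<close>.
\<close>

abbreviation cspace :: "nat set \<Rightarrow> (nat \<Rightarrow> complex) set"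
  where "cspace A \<equiv> A \<rightarrow>\<^sub>E UNIV"


subsection \<open>The arrangement and its discriminant\<close>

definition g_lin :: "nat \<Rightarrow> (nat \<Rightarrow> nat \<Rightarrow> complex) \<Rightarrow> nat \<Rightarrow> (nat \<Rightarrow> complex) \<Rightarrow> complex"
  where "g_lin k b j t = (\<Sum>m=1..k. b j m * t m)"

definition f_lin :: "nat \<Rightarrow> (nat \<Rightarrow> nat \<Rightarrow> complex) \<Rightarrow> nat \<Rightarrow> (nat \<Rightarrow> complex) \<Rightarrow> (nat \<Rightarrow> complex) \<Rightarrow> complex"
  where "f_lin k b j z t = z j + g_lin k b j t"

text \<open>Rows and columns of library matrices are numbered from 0, hence the shift in the column.\<close>

definition d_minor :: "nat \<Rightarrow> (nat \<Rightarrow> nat \<Rightarrow> complex) \<Rightarrow> nat list \<Rightarrow> complex"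
  where "d_minor k b is = Determinant.det (mat k k (\<lambda>(l, m). b (is ! l) (Suc m)))"

text \<open>
  The number \<open>m\<close> below runs from 0, so it is one less than in $(-1)^{m-1}$. For a list \<open>is\<close>
  without repetitions, \<open>remove1 (is ! m) is\<close> omits exactly the entry at position \<open>m\<close>.
\<close>

definition f_dep :: "nat \<Rightarrow> (nat \<Rightarrow> nat \<Rightarrow> complex) \<Rightarrow> nat list \<Rightarrow> (nat \<Rightarrow> complex) \<Rightarrow> complex"
  where "f_dep k b is z = (\<Sum>m<Suc k. (-1) ^ m * d_minor k b (remove1 (is ! m) is) * z (is ! m))"

definition discr :: "nat \<Rightarrow> nat \<Rightarrow> (nat \<Rightarrow> nat \<Rightarrow> complex) \<Rightarrow> (nat \<Rightarrow> complex) set"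
  where "discr n k b =
    (\<Union>K\<in>{K. K \<subseteq> {1..n} \<and> card K = k + 1}.
       {z \<in> cspace {1..n}. f_dep k b (sorted_list_of_set K) z = 0})"

definition U0 :: "nat \<Rightarrow> nat \<Rightarrow> (nat \<Rightarrow> nat \<Rightarrow> complex) \<Rightarrow> ((nat \<Rightarrow> complex) \<times> (nat \<Rightarrow> complex)) set"
  where "U0 n k b =
    {(z, t). z \<in> cspace {1..n} \<and> t \<in> cspace {1..k} \<and> z \<notin> discr n k b \<and>
             (\<forall>j\<in>{1..n}. f_lin k b j z t \<noteq> 0)}"


subsection \<open>Partial derivatives of multivalued functions\<close>

text \<open>
  A multivalued function of two groups of variables is given by assigning to each point the set
  of its branches near that point. Its partial derivative is the common value of the partial
  derivatives of all these branches.
\<close>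

type_synonym point = "(nat \<Rightarrow> complex) \<times> (nat \<Rightarrow> complex)"
type_synonym multifun = "point \<Rightarrow> (point \<Rightarrow> complex) set"

definition partial1 :: "multifun \<Rightarrow> nat \<Rightarrow> point \<Rightarrow> complex"
  where "partial1 B i = (\<lambda>(x, y).
    THE D. \<forall>F\<in>B (x, y). ((\<lambda>s. F (x(i := s), y)) has_field_derivative D) (at (x i)))"

definition partial2 :: "multifun \<Rightarrow> nat \<Rightarrow> point \<Rightarrow> complex"
  where "partial2 B i = (\<lambda>(x, y).
    THE D. \<forall>F\<in>B (x, y). ((\<lambda>s. F (x, y(i := s))) has_field_derivative D) (at (y i)))"

definition log_branch :: "complex \<Rightarrow> (complex \<Rightarrow> complex) \<Rightarrow> bool"
  where "log_branch w L \<longleftrightarrow>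
    (\<exists>S. open S \<and> w \<in> S \<and> L holomorphic_on S \<and> (\<forall>u\<in>S. exp (L u) = u))"


subsection \<open>The master function and the Lagrangian variety\<close>

definition Phi :: "nat \<Rightarrow> nat \<Rightarrow> (nat \<Rightarrow> nat \<Rightarrow> complex) \<Rightarrow> (nat \<Rightarrow> complex) \<Rightarrow> multifun"
  where "Phi n k b a = (\<lambda>(z\<^sub>0, t\<^sub>0).
    {\<lambda>(z, t). \<Sum>j=1..n. a j * L j (f_lin k b j z t) |L. \<forall>j\<in>{1..n}. log_branch (f_lin k b j z\<^sub>0 t\<^sub>0) (L j)})"

definition C_Phi :: "nat \<Rightarrow> nat \<Rightarrow> (nat \<Rightarrow> nat \<Rightarrow> complex) \<Rightarrow> (nat \<Rightarrow> complex) \<Rightarrow> point set"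
  where "C_Phi n k b a =
    {(z, t) \<in> U0 n k b. \<forall>i\<in>{1..k}. partial2 (Phi n k b a) i (z, t) = 0}"

definition phi :: "nat \<Rightarrow> nat \<Rightarrow> (nat \<Rightarrow> nat \<Rightarrow> complex) \<Rightarrow> (nat \<Rightarrow> complex) \<Rightarrow> point \<Rightarrow> point"
  where "phi n k b a = (\<lambda>(z, t). (z, \<lambda>j\<in>{1..n}. partial1 (Phi n k b a) j (z, t)))"

definition Lambda :: "nat \<Rightarrow> nat \<Rightarrow> (nat \<Rightarrow> nat \<Rightarrow> complex) \<Rightarrow> (nat \<Rightarrow> complex) \<Rightarrow> point set"
  where "Lambda n k b a = phi n k b a ` C_Phi n k b a"


subsection \<open>The generating function\<close>

text \<open>
  The list \<open>is\<close> enumerates \<open>I\<close>, and \<open>p_expr n k b is q\<close> is the vector $p$ with $p_{\bar I} = q$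
  whose entries $p_i$, $i\in I$, are expressed through \<open>q\<close>. For $i = i_m$, the list
  \<open>i # remove1 i is\<close> is $i_m,i_1,\dots,\widehat{i_m},\dots,i_k$.
\<close>

definition p_expr ::
    "nat \<Rightarrow> nat \<Rightarrow> (nat \<Rightarrow> nat \<Rightarrow> complex) \<Rightarrow> nat list \<Rightarrow> (nat \<Rightarrow> complex) \<Rightarrow> nat \<Rightarrow> complex"
  where "p_expr n k b is q = (\<lambda>i\<in>{1..n}.
    if i \<in> set is
    then - (1 / d_minor k b (i # remove1 i is)) * (\<Sum>j\<in>{1..n} - set is. d_minor k b (j # remove1 i is) * q j)
    else q i)"

definition Psi ::
    "nat \<Rightarrow> (nat \<Rightarrow> complex) \<Rightarrow> nat set \<Rightarrow> (nat \<Rightarrow> complex \<Rightarrow> complex) \<Rightarrow> point \<Rightarrow> complex"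
  where "Psi n a I L = (\<lambda>(z, p). (\<Sum>j=1..n. a j * L j (p j)) - (\<Sum>i\<in>I. z i * p i))"

definition Psi_I ::
    "nat \<Rightarrow> nat \<Rightarrow> (nat \<Rightarrow> nat \<Rightarrow> complex) \<Rightarrow> (nat \<Rightarrow> complex) \<Rightarrow> nat list \<Rightarrow> multifun"
  where "Psi_I n k b a is = (\<lambda>(z\<^sub>0, q\<^sub>0).
    {\<lambda>(z, q). Psi n a (set is) L (z, p_expr n k b is q) |L.
       \<forall>j\<in>{1..n}. log_branch (p_expr n k b is q\<^sub>0 j) (L j)})"

definition gen_dom :: "nat \<Rightarrow> nat \<Rightarrow> (nat \<Rightarrow> nat \<Rightarrow> complex) \<Rightarrow> nat list \<Rightarrow> point set"
  where "gen_dom n k b is =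
    {(z, q). z \<in> cspace (set is) \<and> q \<in> cspace ({1..n} - set is) \<and>
             (\<forall>j\<in>{1..n}. p_expr n k b is q j \<noteq> 0)}"

definition gen_map ::
    "nat \<Rightarrow> nat \<Rightarrow> (nat \<Rightarrow> nat \<Rightarrow> complex) \<Rightarrow> (nat \<Rightarrow> complex) \<Rightarrow> nat list \<Rightarrow> point \<Rightarrow> point"
  where "gen_map n k b a is = (\<lambda>(z, q).
    (\<lambda>j\<in>{1..n}. if j \<in> set is then z j else partial2 (Psi_I n k b a is) j (z, q),
     \<lambda>j\<in>{1..n}. if j \<in> set is then - partial1 (Psi_I n k b a is) j (z, q) else q j))"


subsection \<open>The partial derivatives are single-valued\<close>

lemma log_branch_exists:
  assumes "w \<noteq> 0"
  shows "\<exists>L. log_branch w L"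
proof
  let ?L = "\<lambda>u. Ln (u / w) + Ln w"
  let ?S = "ball w (norm w)"
  have nz: "u \<noteq> 0" if "u \<in> ?S" for u
    using that by (auto simp: dist_norm)
  have re: "u / w \<notin> \<real>\<^sub>\<le>\<^sub>0" if "u \<in> ?S" for u
  proof
    assume "u / w \<in> \<real>\<^sub>\<le>\<^sub>0"
    then obtain r :: real where r: "u / w = of_real r" "r \<le> 0"
      by (auto elim: nonpos_Reals_cases)
    then have "w - u = of_real (1 - r) * w"
      using assms by (simp add: field_simps)
    then have "norm (w - u) = (1 - r) * norm w"
      using r(2) by (metis abs_of_nonneg diff_ge_0_iff_ge norm_mult norm_of_real order_trans zero_le_one)
    moreover have "norm (w - u) < norm w"
      using that by (simp add: dist_norm)
    ultimately have "(1 - r) * norm w < norm w"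
      by simp
    moreover have "1 * norm w \<le> (1 - r) * norm w"
      using r(2) by (intro mult_right_mono) auto
    ultimately show False
      by linarith
  qed
  have "?L holomorphic_on ?S"
    using re by (intro holomorphic_intros) (auto simp: assms)
  moreover have "exp (?L u) = u" if "u \<in> ?S" for u
    using nz[OF that] assms by (simp add: exp_add)
  moreover have "open ?S" "w \<in> ?S"
    using assms by auto
  ultimately show "log_branch w ?L"
    unfolding log_branch_def by blast
qed

lemma log_branch_nonzero: "log_branch w L \<Longrightarrow> w \<noteq> 0"
  unfolding log_branch_def by (metis exp_not_eq_zero)

lemma log_branch_deriv:
  assumes "log_branch w L"
  shows "(L has_field_derivative 1 / w) (at w)"
proof -
  obtain S where S: "open S" "w \<in> S" "L holomorphic_on S" "\<And>u. u \<in> S \<Longrightarrow> exp (L u) = u"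
    using assms unfolding log_branch_def by blast
  then obtain D where D: "(L has_field_derivative D) (at w)"
    using holomorphic_on_imp_differentiable_at field_differentiable_def by metis
  have "((\<lambda>u. exp (L u)) has_field_derivative exp (L w) * D) (at w)"
    using D by (auto intro!: derivative_eq_intros)
  moreover have "((\<lambda>u. exp (L u)) has_field_derivative 1) (at w)"
    by (rule has_field_derivative_transform_within_open[OF DERIV_ident S(1,2)]) (simp add: S(4))
  ultimately have "w * D = 1"
    using DERIV_unique S(2,4) by fastforce
  then show ?thesis
    using D by (metis log_branch_nonzero[OF assms] nonzero_mult_div_cancel_left)
qed

lemma log_branches_exist:
  assumes "\<And>j. j \<in> J \<Longrightarrow> w j \<noteq> 0"
  shows "\<exists>L. \<forall>j\<in>J. log_branch (w j) (L j)"
  using assms log_branch_exists by (intro bchoice ballI) auto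

lemma partial1_eqI:
  assumes "B (x, y) \<noteq> {}"
    and "\<And>F. F \<in> B (x, y) \<Longrightarrow> ((\<lambda>s. F (x(i := s), y)) has_field_derivative D) (at (x i))"
  shows "partial1 B i (x, y) = D"
  unfolding partial1_def using assms by (auto intro!: the_equality dest: DERIV_unique)

lemma partial2_eqI:
  assumes "B (x, y) \<noteq> {}"
    and "\<And>F. F \<in> B (x, y) \<Longrightarrow> ((\<lambda>s. F (x, y(i := s))) has_field_derivative D) (at (y i))"
  shows "partial2 B i (x, y) = D"
  unfolding partial2_def using assms by (auto intro!: the_equality dest: DERIV_unique)

lemma DERIV_fun_upd: "((\<lambda>s. (y(i := s)) j) has_field_derivative (if j = i then 1 else 0)) F"
  by (cases "j = i") (auto intro!: derivative_eq_intros)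

lemma partial1_Phi:
  assumes "\<And>j. j \<in> {1..n} \<Longrightarrow> f_lin k b j z t \<noteq> 0" and "i \<in> {1..n}"
  shows "partial1 (Phi n k b a) i (z, t) = a i / f_lin k b i z t"
proof (rule partial1_eqI)
  show "Phi n k b a (z, t) \<noteq> {}"
    using log_branches_exist[of "{1..n}" "\<lambda>j. f_lin k b j z t"] assms(1) by (auto simp: Phi_def)
next
  fix F assume "F \<in> Phi n k b a (z, t)"
  then obtain L where L: "\<And>j. j \<in> {1..n} \<Longrightarrow> log_branch (f_lin k b j z t) (L j)"
    and F: "F = (\<lambda>(z, t). \<Sum>j=1..n. a j * L j (f_lin k b j z t))"
    unfolding Phi_def split by blast
  have "((\<lambda>s. L j (f_lin k b j (z(i := s)) t)) has_field_derivative
      1 / f_lin k b j z t * (if j = i then 1 else 0)) (at (z i))" if "j \<in> {1..n}" for j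
  proof (rule DERIV_chain2[where f = "L j"])
    show "(L j has_field_derivative 1 / f_lin k b j z t) (at (f_lin k b j (z(i := z i)) t))"
      using log_branch_deriv[OF L[OF that]] by simp
    show "((\<lambda>s. f_lin k b j (z(i := s)) t) has_field_derivative (if j = i then 1 else 0)) (at (z i))"
      unfolding f_lin_def by (rule derivative_eq_intros DERIV_fun_upd refl)+ simp
  qed
  then have "((\<lambda>s. F (z(i := s), t)) has_field_derivative
      (\<Sum>j=1..n. a j * (1 / f_lin k b j z t * (if j = i then 1 else 0)))) (at (z i))"
    unfolding F split by (intro DERIV_sum DERIV_cmult) auto
  moreover have "(\<Sum>j=1..n. a j * (1 / f_lin k b j z t * (if j = i then 1 else 0)))
      = (\<Sum>j=1..n. if j = i then a j / f_lin k b j z t else 0)"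
    by (rule sum.cong) auto
  ultimately show "((\<lambda>s. F (z(i := s), t)) has_field_derivative a i / f_lin k b i z t) (at (z i))"
    using assms(2) by simp
qed

lemma partial2_Phi:
  assumes "\<And>j. j \<in> {1..n} \<Longrightarrow> f_lin k b j z t \<noteq> 0" and "i \<in> {1..k}"
  shows "partial2 (Phi n k b a) i (z, t) = (\<Sum>j=1..n. b j i * a j / f_lin k b j z t)"
proof (rule partial2_eqI)
  show "Phi n k b a (z, t) \<noteq> {}"
    using log_branches_exist[of "{1..n}" "\<lambda>j. f_lin k b j z t"] assms(1) by (auto simp: Phi_def)
next
  fix F assume "F \<in> Phi n k b a (z, t)"
  then obtain L where L: "\<And>j. j \<in> {1..n} \<Longrightarrow> log_branch (f_lin k b j z t) (L j)"
    and F: "F = (\<lambda>(z, t). \<Sum>j=1..n. a j * L j (f_lin k b j z t))"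
    unfolding Phi_def split by blast
  have "((\<lambda>s. L j (f_lin k b j z (t(i := s)))) has_field_derivative
      1 / f_lin k b j z t * b j i) (at (t i))" if "j \<in> {1..n}" for j
  proof (rule DERIV_chain2[where f = "L j"])
    show "(L j has_field_derivative 1 / f_lin k b j z t) (at (f_lin k b j z (t(i := t i))))"
      using log_branch_deriv[OF L[OF that]] by simp
    have "((\<lambda>s. f_lin k b j z (t(i := s))) has_field_derivative
        0 + (\<Sum>m=1..k. b j m * (if m = i then 1 else 0))) (at (t i))"
      unfolding f_lin_def g_lin_def by (intro DERIV_add DERIV_const DERIV_sum DERIV_cmult DERIV_fun_upd)
    moreover have "(\<Sum>m=1..k. b j m * (if m = i then 1 else 0)) = (\<Sum>m=1..k. if m = i then b j m else 0)"
      by (rule sum.cong) auto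
    ultimately show "((\<lambda>s. f_lin k b j z (t(i := s))) has_field_derivative b j i) (at (t i))"
      using assms(2) by simp
  qed
  then have "((\<lambda>s. F (z, t(i := s))) has_field_derivative
      (\<Sum>j=1..n. a j * (1 / f_lin k b j z t * b j i))) (at (t i))"
    unfolding F split by (intro DERIV_sum DERIV_cmult) auto
  moreover have "(\<Sum>j=1..n. a j * (1 / f_lin k b j z t * b j i)) = (\<Sum>j=1..n. b j i * a j / f_lin k b j z t)"
    by (rule sum.cong) auto
  ultimately show "((\<lambda>s. F (z, t(i := s))) has_field_derivative
      (\<Sum>j=1..n. b j i * a j / f_lin k b j z t)) (at (t i))"
    by simp
qed

lemma partial1_Psi_I:
  assumes "\<And>j. j \<in> {1..n} \<Longrightarrow> p_expr n k b is q j \<noteq> 0" and "i \<in> set is"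
  shows "partial1 (Psi_I n k b a is) i (z, q) = - p_expr n k b is q i"
proof (rule partial1_eqI)
  show "Psi_I n k b a is (z, q) \<noteq> {}"
    using log_branches_exist[of "{1..n}" "p_expr n k b is q"] assms(1) by (auto simp: Psi_I_def)
next
  let ?p = "p_expr n k b is q"
  fix F assume "F \<in> Psi_I n k b a is (z, q)"
  then obtain L where F: "F = (\<lambda>(z, q). Psi n a (set is) L (z, p_expr n k b is q))"
    by (auto simp: Psi_I_def)
  have "((\<lambda>s. \<Sum>j\<in>set is. (z(i := s)) j * ?p j) has_field_derivative
      (\<Sum>j\<in>set is. (if j = i then 1 else 0) * ?p j)) (at (z i))"
    by (intro DERIV_sum DERIV_cmult_right DERIV_fun_upd)
  moreover have "(\<Sum>j\<in>set is. (if j = i then 1 else 0) * ?p j) = (\<Sum>j\<in>set is. if j = i then ?p j else 0)"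
    by (rule sum.cong) auto
  ultimately have "((\<lambda>s. \<Sum>j\<in>set is. (z(i := s)) j * ?p j) has_field_derivative ?p i) (at (z i))"
    using assms(2) by simp
  from DERIV_diff[OF DERIV_const this]
  show "((\<lambda>s. F (z(i := s), q)) has_field_derivative - ?p i) (at (z i))"
    unfolding F Psi_def split by simp
qed

lemma DERIV_p_expr:
  "\<exists>D. ((\<lambda>s. p_expr n k b is (q(i := s)) j) has_field_derivative D) (at (q i))"
proof -
  have "(\<lambda>s. p_expr n k b is (q(i := s)) j) field_differentiable at (q i)"
  proof (cases "j \<in> {1..n}")
    case False
    then show ?thesis by (auto simp: p_expr_def)
  next
    case j: True
    have upd: "(\<lambda>s. (q(i := s)) l) field_differentiable at (q i)" for l
      unfolding field_differentiable_def by (rule exI[where x = "if l = i then 1 else 0"], rule DERIV_fun_upd)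
    have "(\<lambda>s. c * (\<Sum>l\<in>A. e l * (q(i := s)) l)) field_differentiable at (q i)" for c e A
      by (intro derivative_intros upd)
    from this[of "- (1 / d_minor k b (j # remove1 j is))"] show ?thesis
      using j upd unfolding p_expr_def
      by (cases "j \<in> set is") (simp_all del: fun_upd_apply)
  qed
  then show ?thesis by (simp add: field_differentiable_def)
qed

lemma partial2_Psi_I:
  assumes "\<And>j. j \<in> {1..n} \<Longrightarrow> p_expr n k b is q j \<noteq> 0" and "F \<in> Psi_I n k b a is (z, q)"
  shows "((\<lambda>s. F (z, q(i := s))) has_field_derivative partial2 (Psi_I n k b a is) i (z, q)) (at (q i))"
proof -
  let ?p = "p_expr n k b is q"
  obtain D where D: "\<And>j. ((\<lambda>s. p_expr n k b is (q(i := s)) j) has_field_derivative D j) (at (q i))"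
    using DERIV_p_expr by metis
  let ?E = "(\<Sum>j=1..n. a j * (1 / ?p j * D j)) - (\<Sum>j\<in>set is. z j * D j)"
  have E: "((\<lambda>s. F (z, q(i := s))) has_field_derivative ?E) (at (q i))"
    if F: "F \<in> Psi_I n k b a is (z, q)" for F
  proof -
    obtain L where L: "\<And>j. j \<in> {1..n} \<Longrightarrow> log_branch (?p j) (L j)"
      and F: "F = (\<lambda>(z, q). Psi n a (set is) L (z, p_expr n k b is q))"
      using F unfolding Psi_I_def split by blast
    have "((\<lambda>s. L j (p_expr n k b is (q(i := s)) j)) has_field_derivative 1 / ?p j * D j) (at (q i))"
      if "j \<in> {1..n}" for j
      by (rule DERIV_chain2[OF _ D]) (use log_branch_deriv[OF L[OF that]] in simp)
    then show ?thesis
      unfolding F Psi_def split by (intro DERIV_diff DERIV_sum DERIV_cmult D) auto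
  qed
  then have "partial2 (Psi_I n k b a is) i (z, q) = ?E"
    using assms(2) by (intro partial2_eqI) auto
  then show ?thesis using E assms(2) by simp
qed

lemma Psi_I_nonempty:
  assumes "\<And>j. j \<in> {1..n} \<Longrightarrow> p_expr n k b is q j \<noteq> 0"
  shows "Psi_I n k b a is (z, q) \<noteq> {}"
  using log_branches_exist[of "{1..n}" "p_expr n k b is q"] assms by (auto simp: Psi_I_def)

end

theory Submission
  imports Defs
begin

text \<open>
  Write \<open>b\<^sub>j\<close> for the coefficient vector $(b_j^1,\dots,b_j^k)$ of $g_j$. At a critical point
  $\sum_j b_j^m a_j/f_j = 0$ for all $m$, so the momenta $p_j = a_j/f_j$ form a linear relation
  $\sum_j p_j b_j = 0$ among the \<open>n\<close> vectors \<open>b\<^sub>j\<close> of $\mathbb C^k$. The vectors \<open>b\<^sub>i\<close>, $i\in I$,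
  are a basis, so such a relation is determined by its coefficients outside \<open>I\<close>, which
  can be prescribed freely. By Cramer's rule the formulas for $p_I$ in terms of
  $p_{\bar I}$ do exactly this: the vectors \<open>p_expr n k b is q\<close> are relations
  (\<open>p_expr_relation\<close>), and every relation is of this form (\<open>p_expr_eq_if_relation\<close>). This
  settles the momentum half of the claim, because $-\partial\Psi_I/\partial z_i$ is $p_i$
  expressed through $p_{\bar I}$.

  For the coordinate half take $i\in\bar I$. As $p$ depends linearly on $p_{\bar I}$, the vector
  $e = \partial p/\partial p_i$ is \<open>p_expr\<close> of a unit vector, hence itself a relation
  among the \<open>b\<^sub>j\<close>. Since $a_j/p_j = f_j = z_j + g_j(t)$ on $\Lambda$, the chain rule gives
  \[ \frac{\partial\Psi_I}{\partial p_i} = \sum_{j\in J}(z_j + g_j(t))\,e_j - \sum_{j\in I} z_j e_j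
     = z_i + \sum_{j\in J} g_j(t)\,e_j , \]
  because $e$ restricts to the $i$-th unit vector on $\bar I$. The last sum is
  $\sum_m t_m\sum_j b_j^m e_j = 0$.
\<close>

section \<open>Minors as linear functions of their first row\<close>

text \<open>The coefficients are the cofactors along the first row, which do not involve that row.\<close>

lemma d_minor_Cons_linear:
  assumes "Suc (length js) = k"
  obtains c where "\<And>l. d_minor k b (l # js) = (\<Sum>m=1..k. b l m * c m)"
proof -
  let ?M = "\<lambda>l. mat k k (\<lambda>(r, m). b ((l # js) ! r) (Suc m))"
  \<comment> \<open>The 0 in \<open>?M 0\<close> is an arbitrary choice of first row: the cofactor deletes that row.\<close>
  define c where "c m = cofactor (?M 0) 0 (m - 1)" for m
  have "d_minor k b (l # js) = (\<Sum>m=1..k. b l m * c m)" for l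
  proof -
    have del: "mat_delete (?M l) 0 m = mat_delete (?M 0) 0 m" if "m < k" for m
      using that by (intro eq_matI) (auto simp: mat_delete_def)
    have "d_minor k b (l # js) = (\<Sum>m<k. ?M l $$ (0, m) * cofactor (?M l) 0 m)"
      unfolding d_minor_def using assms by (intro laplace_expansion_row) auto
    also have "\<dots> = (\<Sum>m<k. b l (Suc m) * c (Suc m))"
      using assms del by (intro sum.cong) (auto simp: c_def cofactor_def)
    also have "\<dots> = (\<Sum>m=1..k. b l m * c m)"
      by (intro sum.reindex_bij_witness[where i = "\<lambda>m. m - 1" and j = Suc]) auto
    finally show ?thesis .
  qed
  then show thesis by (rule that)
qed

lemma d_minor_Cons_relation:
  assumes "Suc (length js) = k"
    and "\<And>m. m \<in> {1..k} \<Longrightarrow> (\<Sum>l\<in>A. b l m * x l) = 0"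
  shows "(\<Sum>l\<in>A. d_minor k b (l # js) * x l) = 0"
proof -
  obtain c where c: "\<And>l. d_minor k b (l # js) = (\<Sum>m=1..k. b l m * c m)"
    using d_minor_Cons_linear[OF assms(1)] by blast
  have "(\<Sum>l\<in>A. d_minor k b (l # js) * x l) = (\<Sum>l\<in>A. \<Sum>m=1..k. c m * (b l m * x l))"
    unfolding c sum_distrib_right by (intro sum.cong) auto
  also have "\<dots> = (\<Sum>m=1..k. c m * (\<Sum>l\<in>A. b l m * x l))"
    by (subst sum.swap) (simp add: sum_distrib_left)
  also have "\<dots> = 0" using assms(2) by simp
  finally show ?thesis .
qed

lemma d_minor_Cons_eq_0:
  assumes "Suc (length js) = k" and "l \<in> set js"
  shows "d_minor k b (l # js) = 0"
proof -
  obtain r where r: "r < length js" "js ! r = l"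
    using assms(2) by (auto simp: in_set_conv_nth)
  show ?thesis
    unfolding d_minor_def
  proof (rule det_identical_rows[where i = 0 and j = "Suc r"])
    show "row (mat k k (\<lambda>(r, m). b ((l # js) ! r) (Suc m))) 0 =
          row (mat k k (\<lambda>(r, m). b ((l # js) ! r) (Suc m))) (Suc r)"
      using r assms(1) by (intro eq_vecI) auto
  qed (use r assms(1) in auto)
qed

text \<open>
  A nonzero minor makes its \<open>k\<close> rows a basis of $\mathbb C^k$; the coordinates of \<open>v\<close> are found by
  inverting the transposed matrix.
\<close>

lemma d_minor_nonzero_imp_spanning:
  assumes "d_minor k b is \<noteq> 0" and "length is = k" and "distinct is"
  obtains x where "\<And>m. m \<in> {1..k} \<Longrightarrow> (\<Sum>i\<in>set is. b i m * x i) = v m"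
proof -
  let ?M = "mat k k (\<lambda>(l, m). b (is ! l) (Suc m))"
  let ?N = "transpose_mat ?M"
  let ?v = "vec k (\<lambda>m. v (Suc m))"
  have N: "?N \<in> carrier_mat k k" by simp
  have "Determinant.det ?N \<noteq> 0"
    using assms(1) by (subst det_transpose[of _ k]) (auto simp: d_minor_def)
  from det_non_zero_imp_unit[OF N this, of "()"]
  obtain B where B: "B \<in> carrier_mat k k" "?N * B = 1\<^sub>m k"
    by (auto simp: Units_def ring_mat_def)
  define y where "y = B *\<^sub>v ?v"
  have y: "y \<in> carrier_vec k" using B(1) by (auto simp: y_def)
  have "?N *\<^sub>v y = ?v"
    unfolding y_def using assoc_mult_mat_vec[OF N B(1), of ?v] B(2) by simp
  then have eq: "(?N *\<^sub>v y) $ m = v (Suc m)" if "m < k" for m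
    using that by simp
  define pos where "pos = the_inv_into {..<k} ((!) is)"
  have inj: "inj_on ((!) is) {..<k}"
    using assms(2,3) by (auto simp: inj_on_def nth_eq_iff_index_eq)
  have set_is: "set is = (!) is ` {..<k}"
    using assms(2) by (auto simp: set_conv_nth)
  have "(\<Sum>i\<in>set is. b i m * y $ pos i) = v m" if m: "m \<in> {1..k}" for m
  proof -
    have "(\<Sum>i\<in>set is. b i m * y $ pos i) = (\<Sum>l<k. b (is ! l) m * y $ l)"
      unfolding set_is sum.reindex[OF inj] by (simp add: pos_def the_inv_into_f_f[OF inj])
    also have "\<dots> = (?N *\<^sub>v y) $ (m - 1)"
      using m y by (auto simp: scalar_prod_def lessThan_atLeast0 intro!: sum.cong)
    also have "\<dots> = v (Suc (m - 1))" by (rule eq) (use m in auto)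
    also have "\<dots> = v m" using m by simp
    finally show ?thesis .
  qed
  then show thesis by (rule that)
qed

section \<open>Linear relations between the coefficient vectors\<close>

lemma p_expr_cong:
  assumes "\<And>j. j \<in> {1..n} - set is \<Longrightarrow> q j = q' j"
  shows "p_expr n k b is q = p_expr n k b is q'"
  using assms by (auto simp: p_expr_def fun_eq_iff)

text \<open>
  Cramer's rule. Applying the linear function $v\mapsto\det(v, b_{i_1},\dots,\widehat{b_j},\dots,b_{i_k})$
  to the relation $\sum_l p_l b_l = 0$ kills every term with $l\in I\setminus\{j\}$, because two
  rows coincide, and what is left can be solved for $p_j$.
\<close>

lemma p_expr_eq_if_relation:
  assumes "length is = k" and "distinct is" and "set is \<subseteq> {1..n}"
    and nz: "\<And>i. i \<in> set is \<Longrightarrow> d_minor k b (i # remove1 i is) \<noteq> 0"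
    and rel: "\<And>m. m \<in> {1..k} \<Longrightarrow> (\<Sum>l=1..n. b l m * p l) = 0"
    and "j \<in> {1..n}"
  shows "p_expr n k b is p j = p j"
proof (cases "j \<in> set is")
  case False
  then show ?thesis using assms(6) by (simp add: p_expr_def)
next
  case True
  let ?d = "\<lambda>l. d_minor k b (l # remove1 j is)"
  let ?S = "\<Sum>l\<in>{1..n} - set is. ?d l * p l"
  have len: "Suc (length (remove1 j is)) = k"
    using True assms(1) length_pos_if_in_set[OF True] by (simp add: length_remove1)
  have set_rest: "set (remove1 j is) = set is - {j}"
    using assms(2) by simp
  have "0 = (\<Sum>l=1..n. ?d l * p l)"
    by (rule d_minor_Cons_relation[OF len rel, symmetric])
  also have "\<dots> = ?S + (\<Sum>l\<in>set is. ?d l * p l)"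
    using assms(3) by (intro sum.subset_diff) auto
  also have "(\<Sum>l\<in>set is. ?d l * p l) = ?d j * p j + (\<Sum>l\<in>set is - {j}. ?d l * p l)"
    using True by (intro sum.remove) auto
  also have "(\<Sum>l\<in>set is - {j}. ?d l * p l) = 0"
    using d_minor_Cons_eq_0[OF len] set_rest by (intro sum.neutral) auto
  finally have "?d j * p j = - ?S"
    by (simp add: eq_neg_iff_add_eq_0 add.commute)
  then have "p j = - ?S / ?d j"
    using nz[OF True] by (metis nonzero_mult_div_cancel_left)
  then show ?thesis
    using True assms(6) by (simp add: p_expr_def)
qed

text \<open>
  Rather than verifying the relation from the formula, one completes \<open>q\<close> to some relation, using
  that the \<open>b\<^sub>i\<close> with $i\in I$ span; by the uniqueness just proved it must be \<open>p_expr n k b is q\<close>.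
\<close>

lemma p_expr_relation:
  assumes "length is = k" and "distinct is" and "set is \<subseteq> {1..n}"
    and "d_minor k b is \<noteq> 0"
    and nz: "\<And>i. i \<in> set is \<Longrightarrow> d_minor k b (i # remove1 i is) \<noteq> 0"
    and "m \<in> {1..k}"
  shows "(\<Sum>l=1..n. b l m * p_expr n k b is q l) = 0"
proof -
  let ?C = "{1..n} - set is"
  obtain x where x: "\<And>m. m \<in> {1..k} \<Longrightarrow> (\<Sum>i\<in>set is. b i m * x i) = - (\<Sum>l\<in>?C. b l m * q l)"
    using d_minor_nonzero_imp_spanning[OF assms(4,1,2), where v = "\<lambda>m. - (\<Sum>l\<in>?C. b l m * q l)"] by metis
  define p where "p l = (if l \<in> set is then x l else q l)" for l
  have rel: "(\<Sum>l=1..n. b l m * p l) = 0" if "m \<in> {1..k}" for m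
  proof -
    have "(\<Sum>l=1..n. b l m * p l) = (\<Sum>l\<in>?C. b l m * p l) + (\<Sum>l\<in>set is. b l m * p l)"
      using assms(3) by (intro sum.subset_diff) auto
    also have "(\<Sum>l\<in>?C. b l m * p l) = (\<Sum>l\<in>?C. b l m * q l)"
      by (intro sum.cong) (auto simp: p_def)
    also have "(\<Sum>l\<in>set is. b l m * p l) = (\<Sum>l\<in>set is. b l m * x l)"
      by (intro sum.cong) (auto simp: p_def)
    finally show ?thesis using x[OF that] by simp
  qed
  have "p_expr n k b is q = p_expr n k b is p"
    by (rule p_expr_cong) (auto simp: p_def)
  then have "p_expr n k b is q l = p l" if "l \<in> {1..n}" for l
    using p_expr_eq_if_relation[OF assms(1-3) nz rel that] by simp
  then show ?thesis using rel[OF assms(6)] by simp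
qed

section \<open>The derivative of the generating function\<close>

text \<open>
  This identifies the slope of \<open>p_expr\<close> along a coordinate line as a value of \<open>p_expr\<close>, and so
  as a linear relation between the vectors \<open>b\<^sub>j\<close>.
\<close>

lemma p_expr_fun_upd:
  assumes "i \<in> {1..n} - set is" and "j \<in> {1..n}"
  shows "p_expr n k b is (q(i := s)) j =
         p_expr n k b is (q(i := 0)) j + s * p_expr n k b is (\<lambda>l. if l = i then 1 else 0) j"
proof (cases "j \<in> set is")
  case False
  then show ?thesis using assms by (simp add: p_expr_def)
next
  case True
  let ?d = "\<lambda>l. d_minor k b (l # remove1 j is)"
  let ?C = "{1..n} - set is"
  have "(\<Sum>l\<in>?C. ?d l * (q(i := s)) l) =
        (\<Sum>l\<in>?C. ?d l * (q(i := 0)) l + s * (?d l * (if l = i then 1 else 0)))"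
    by (rule sum.cong) auto
  also have "\<dots> = (\<Sum>l\<in>?C. ?d l * (q(i := 0)) l) + s * (\<Sum>l\<in>?C. ?d l * (if l = i then 1 else 0))"
    by (simp add: sum.distrib sum_distrib_left)
  finally show ?thesis
    using True assms(2) by (simp add: p_expr_def algebra_simps del: fun_upd_apply)
qed

text \<open>
  All branches have this same derivative, since the logarithm of $p_j$ enters it only through
  $1/p_j$. The vector \<open>e\<close> is $\partial p/\partial p_i$.
\<close>

lemma partial2_Psi_I_eq:
  assumes "\<And>j. j \<in> {1..n} \<Longrightarrow> p_expr n k b is q j \<noteq> 0"
    and "set is \<subseteq> {1..n}" and i: "i \<in> {1..n} - set is"
  defines "e \<equiv> p_expr n k b is (\<lambda>l. if l = i then 1 else 0)"
  shows "partial2 (Psi_I n k b a is) i (z, q) =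
         (\<Sum>j=1..n. a j / p_expr n k b is q j * e j) - (\<Sum>j\<in>set is. z j * e j)"
proof (rule partial2_eqI)
  show "Psi_I n k b a is (z, q) \<noteq> {}"
    using assms(1) by (rule Psi_I_nonempty)
next
  let ?p = "p_expr n k b is q"
  fix F assume "F \<in> Psi_I n k b a is (z, q)"
  then obtain L where L: "\<And>j. j \<in> {1..n} \<Longrightarrow> log_branch (?p j) (L j)"
    and F: "F = (\<lambda>(z, q). Psi n a (set is) L (z, p_expr n k b is q))"
    unfolding Psi_I_def split by blast
  have De: "((\<lambda>s. p_expr n k b is (q(i := s)) j) has_field_derivative e j) (at (q i))"
    if j: "j \<in> {1..n}" for j
  proof -
    define c where "c = p_expr n k b is (q(i := 0)) j"
    have "(\<lambda>s. p_expr n k b is (q(i := s)) j) = (\<lambda>s. c + s * e j)"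
      unfolding c_def e_def by (intro ext p_expr_fun_upd[OF i j])
    then show ?thesis by (auto intro!: derivative_eq_intros)
  qed
  have "((\<lambda>s. L j (p_expr n k b is (q(i := s)) j)) has_field_derivative 1 / ?p j * e j) (at (q i))"
    if "j \<in> {1..n}" for j
    by (rule DERIV_chain2[OF _ De[OF that]]) (use log_branch_deriv[OF L[OF that]] in simp)
  then have "((\<lambda>s. F (z, q(i := s))) has_field_derivative
      (\<Sum>j=1..n. a j * (1 / ?p j * e j)) - (\<Sum>j\<in>set is. z j * e j)) (at (q i))"
    unfolding F Psi_def split using assms(2)
    by (intro DERIV_diff DERIV_sum DERIV_cmult De) auto
  then show "((\<lambda>s. F (z, q(i := s))) has_field_derivative
      (\<Sum>j=1..n. a j / ?p j * e j) - (\<Sum>j\<in>set is. z j * e j)) (at (q i))"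
    by simp
qed

section \<open>The generating function of the Lagrangian variety\<close>

theorem theorem3p5:
  fixes n k :: nat
    and b :: "nat \<Rightarrow> nat \<Rightarrow> complex"
    and a :: "nat \<Rightarrow> complex"
    and I :: "nat set"
    and "is" :: "nat list"
  assumes "0 < k" and "k < n"
    and "\<And>js. set js \<subseteq> {1..n} \<Longrightarrow> length js = k \<Longrightarrow> distinct js \<Longrightarrow> d_minor k b js \<noteq> 0"
    and "\<And>j. j \<in> {1..n} \<Longrightarrow> a j \<noteq> 0"
    and "(\<Sum>j=1..n. a j) \<noteq> 0"
    and "I \<subseteq> {1..n}" and "card I = k"
    and "set is = I" and "distinct is"
  shows "Lambda n k b a \<subseteq> gen_map n k b a is ` gen_dom n k b is"
proof
  have sub: "set is \<subseteq> {1..n}" using assms by simp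
  have len: "length is = k" using assms distinct_card by metis
  have nz0: "d_minor k b is \<noteq> 0" using assms(3)[OF sub len assms(9)] .
  have nz: "d_minor k b (i # remove1 i is) \<noteq> 0" if "i \<in> set is" for i
    using that sub len assms(1,9)
    by (intro assms(3)) (auto simp: length_remove1 dest: notin_set_remove1)
  let ?C = "{1..n} - set is"
  fix w assume "w \<in> Lambda n k b a"
  then obtain z t where zt: "(z, t) \<in> C_Phi n k b a" and w: "w = phi n k b a (z, t)"
    by (auto simp: Lambda_def)
  define f where "f j = f_lin k b j z t" for j
  define p where "p j = a j / f j" for j
  have f0: "f j \<noteq> 0" if "j \<in> {1..n}" for j
    using zt that by (auto simp: C_Phi_def U0_def f_def)
  have zext: "z \<in> cspace {1..n}"
    using zt by (auto simp: C_Phi_def U0_def)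
  have w: "w = (z, restrict p {1..n})"
  proof -
    have "partial1 (Phi n k b a) j (z, t) = p j" if "j \<in> {1..n}" for j
      unfolding p_def f_def using f0[unfolded f_def] that by (rule partial1_Phi)
    then show ?thesis
      unfolding w phi_def split by (auto simp: fun_eq_iff)
  qed
  \<comment> \<open>The critical point equations say that \<open>p\<close> is a linear relation.\<close>
  have rel: "(\<Sum>l=1..n. b l m * p l) = 0" if "m \<in> {1..k}" for m
  proof -
    have "partial2 (Phi n k b a) m (z, t) = 0"
      using zt that by (auto simp: C_Phi_def)
    then show ?thesis
      using partial2_Phi[where a = a, OF f0[unfolded f_def] that] by (simp add: p_def f_def)
  qed
  let ?z = "restrict z (set is)" and ?q = "restrict p ?C"
  have "p_expr n k b is ?q = p_expr n k b is p"
    by (rule p_expr_cong) auto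
  then have pe: "p_expr n k b is ?q j = p j" if "j \<in> {1..n}" for j
    using p_expr_eq_if_relation[OF len assms(9) sub nz rel that] by simp
  then have pe0: "p_expr n k b is ?q j \<noteq> 0" if "j \<in> {1..n}" for j
    using that f0 assms(4) by (simp add: p_def)
  have "(?z, ?q) \<in> gen_dom n k b is"
    using pe0 by (auto simp: gen_dom_def)
  moreover have "gen_map n k b a is (?z, ?q) = w"
  proof -
    have "partial2 (Psi_I n k b a is) i (?z, ?q) = z i" if i: "i \<in> ?C" for i
    proof -
      define e where "e = p_expr n k b is (\<lambda>l. if l = i then 1 else 0)"
      have e_out: "e j = (if j = i then 1 else 0)" if "j \<in> ?C" for j
        using that by (simp add: e_def p_expr_def)
      have "(\<Sum>j=1..n. a j / p_expr n k b is ?q j * e j) = (\<Sum>j=1..n. z j * e j + g_lin k b j t * e j)"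
      proof (rule sum.cong)
        fix j assume j: "j \<in> {1..n}"
        have "a j / p_expr n k b is ?q j = f j"
          using pe[OF j] f0[OF j] assms(4)[OF j] by (simp add: p_def)
        then show "a j / p_expr n k b is ?q j * e j = z j * e j + g_lin k b j t * e j"
          by (simp add: f_def f_lin_def distrib_right)
      qed simp
      also have "\<dots> = (\<Sum>j=1..n. z j * e j) + (\<Sum>j=1..n. g_lin k b j t * e j)"
        by (rule sum.distrib)
      also have "(\<Sum>j=1..n. g_lin k b j t * e j) = (\<Sum>j=1..n. \<Sum>m=1..k. t m * (b j m * e j))"
        unfolding g_lin_def sum_distrib_right by (intro sum.cong) auto
      also have "\<dots> = (\<Sum>m=1..k. t m * (\<Sum>j=1..n. b j m * e j))"
        by (subst sum.swap) (simp add: sum_distrib_left)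
      \<comment> \<open>\<open>e\<close> is a linear relation, too, so the terms with \<open>t\<close> cancel.\<close>
      also have "\<dots> = 0"
        using p_expr_relation[OF len assms(9) sub nz0 nz] by (simp add: e_def)
      also have "(\<Sum>j=1..n. z j * e j) = (\<Sum>j\<in>?C. z j * e j) + (\<Sum>j\<in>set is. z j * e j)"
        using sub by (intro sum.subset_diff) auto
      also have "(\<Sum>j\<in>?C. z j * e j) = (\<Sum>j\<in>?C. if j = i then z j else 0)"
        by (intro sum.cong) (auto simp: e_out)
      also have "\<dots> = z i" using i by simp
      also have "(\<Sum>j\<in>set is. z j * e j) = (\<Sum>j\<in>set is. ?z j * e j)"
        by (intro sum.cong) auto
      finally have "(\<Sum>j=1..n. a j / p_expr n k b is ?q j * e j) - (\<Sum>j\<in>set is. ?z j * e j) = z i"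
        by (simp only: add_0_right add_diff_cancel_right')
      moreover have "partial2 (Psi_I n k b a is) i (?z, ?q) =
          (\<Sum>j=1..n. a j / p_expr n k b is ?q j * e j) - (\<Sum>j\<in>set is. ?z j * e j)"
        unfolding e_def using pe0 sub i by (rule partial2_Psi_I_eq)
      ultimately show ?thesis by (rule trans[rotated])
    qed
    moreover have "- partial1 (Psi_I n k b a is) i (?z, ?q) = p i" if "i \<in> set is" for i
      using partial1_Psi_I[OF pe0 that] pe that sub by auto
    ultimately show ?thesis
      unfolding w gen_map_def split using zext
      by (auto simp: fun_eq_iff PiE_def extensional_def)
  qed
  ultimately show "w \<in> gen_map n k b a is ` gen_dom n k b is"
    by (metis image_eqI)
qed

end
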